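(* For any $q\ge 1$ and $n\ge 5$, the graph $A\Gamma_n^q$ is connected and non-bipartite.
   Context: $X=\{1,\dots,n\}$, $A_n$ the alternating group on $X$, $\mathcal{E}_n=\{\sigma\in A_n: i^\sigma\neq i \text{ for all } i\in X\}$. $A\Gamma_n$ is the Cayley graph $\Gamma(A_n,\mathcal{E}_n)$ (vertex set $A_n$, edges $\{g,sg\}$, $s\in\mathcal{E}_n$). The tensor product of graphs $\Gamma_1,\Gamma_2$ has vertex set $V(\Gamma_1)\times V(\Gamma_2)$, $(u_1,u_2)\sim(v_1,v_2)$ iff $u_1\sim v_1$ and $u_2\sim v_2$. $A\Gamma_n^q$ is the tensor product of $q$ copies of $A\Gamma_n$, with vertex set $A_n^q$. *)

theory Defs
  imports "HOL-Algebra.Sym_Groups" "Graph_Theory.Graph_Theory"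
begin

text \<open>
  Undirected graphs are symmetric digraphs: the edge \<open>{u, v}\<close> is the pair of arcs \<open>(u, v)\<close>, \<open>(v, u)\<close>.
  Connectedness is the notion \<open>Digraph_Component.connected\<close> of the library.
\<close>

definition cayley_graph :: "('a, 'b) monoid_scheme \<Rightarrow> 'a set \<Rightarrow> 'a pair_pre_digraph" where
  "cayley_graph G S =
     \<lparr> pverts = carrier G,
       parcs = (\<Union>g\<in>carrier G. \<Union>s\<in>S. {(g, s \<otimes>\<^bsub>G\<^esub> g), (s \<otimes>\<^bsub>G\<^esub> g, g)}) \<rparr>"

definition even_derangements :: "nat \<Rightarrow> (nat \<Rightarrow> nat) set" where
  "even_derangements n = {\<sigma> \<in> carrier (alt_group n). \<forall>i\<in>{1..n}. \<sigma> i \<noteq> i}"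

definition alt_derangement_graph :: "nat \<Rightarrow> (nat \<Rightarrow> nat) pair_pre_digraph" where
  "alt_derangement_graph n = cayley_graph (alt_group n) (even_derangements n)"

definition tensor_product ::
    "'a pair_pre_digraph \<Rightarrow> 'b pair_pre_digraph \<Rightarrow> ('a \<times> 'b) pair_pre_digraph" where
  "tensor_product G H =
     \<lparr> pverts = pverts G \<times> pverts H,
       parcs = {((u1, u2), (v1, v2)) | u1 u2 v1 v2. (u1, v1) \<in> parcs G \<and> (u2, v2) \<in> parcs H} \<rparr>"

text \<open>
  The \<open>q\<close>-tuples of vertices are lists of length \<open>q\<close>, so that the type does not depend on \<open>q\<close>.
  Lemmas \<open>tensor_power_1\<close> and \<open>tensor_power_Suc\<close> identify this with the iterated binary product,
  up to the re-bracketing of tuples.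
\<close>

definition tensor_power :: "'a pair_pre_digraph \<Rightarrow> nat \<Rightarrow> 'a list pair_pre_digraph" where
  "tensor_power G q =
     \<lparr> pverts = {us. length us = q \<and> set us \<subseteq> pverts G},
       parcs = {(us, vs). length us = q \<and> length vs = q \<and> (\<forall>i<q. (us ! i, vs ! i) \<in> parcs G)} \<rparr>"

definition bipartite :: "('a, 'b) pre_digraph \<Rightarrow> bool" where
  "bipartite G \<longleftrightarrow>
     (\<exists>U V. verts G = U \<union> V \<and> U \<inter> V = {} \<and> arcs_ends G \<subseteq> U \<times> V \<union> V \<times> U)"

lemma tensor_power_1:
  "tensor_power G 1 =
     \<lparr> pverts = (\<lambda>u. [u]) ` pverts G, parcs = map_prod (\<lambda>u. [u]) (\<lambda>u. [u]) ` parcs G \<rparr>"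
  by (force simp: tensor_power_def length_Suc_conv image_iff)

lemma tensor_power_Suc:
  fixes G :: "'a pair_pre_digraph"
  defines "cons \<equiv> \<lambda>(u :: 'a, us). u # us"
  shows "tensor_power G (Suc q) =
     \<lparr> pverts = cons ` pverts (tensor_product G (tensor_power G q)),
       parcs = map_prod cons cons ` parcs (tensor_product G (tensor_power G q)) \<rparr>"
proof -
  have "pverts (tensor_power G (Suc q)) = cons ` pverts (tensor_product G (tensor_power G q))"
    by (force simp: tensor_power_def tensor_product_def cons_def length_Suc_conv image_iff)
  moreover have "parcs (tensor_power G (Suc q))
      = map_prod cons cons ` parcs (tensor_product G (tensor_power G q))" (is "?L = ?R")
  proof
    show "?L \<subseteq> ?R"
    proof
      fix a assume "a \<in> ?L"
      then obtain u us v vs where a: "a = (u # us, v # vs)"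
        and h: "length us = q" "length vs = q" "\<forall>i<Suc q. ((u # us) ! i, (v # vs) ! i) \<in> parcs G"
        by (auto simp: tensor_power_def length_Suc_conv)
      from h(3) have "(u, v) \<in> parcs G" "\<forall>i<q. (us ! i, vs ! i) \<in> parcs G"
        by (auto simp: All_less_Suc2)
      with h have "((u, us), (v, vs)) \<in> parcs (tensor_product G (tensor_power G q))"
        by (auto simp: tensor_power_def tensor_product_def)
      then have "map_prod cons cons ((u, us), (v, vs)) \<in> ?R" by (rule imageI)
      then show "a \<in> ?R" by (simp add: a cons_def)
    qed
    show "?R \<subseteq> ?L"
      by (auto simp: tensor_power_def tensor_product_def cons_def All_less_Suc2)
  qed
  ultimately show ?thesis by (simp add: tensor_power_def)
qed

text \<open>
  The product of \<open>alt_group n\<close> is composition of functions, \<open>s \<otimes> g = s \<circ> g\<close>, whereas for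
  permutations acting on the right \<open>s g\<close> is the function \<open>g \<circ> s\<close>. Since the derangements
  are closed under conjugation, both conventions give the same graph.
\<close>

lemma parcs_alt_derangement_graph_right_action:
  "parcs (alt_derangement_graph n) =
     (\<Union>g\<in>carrier (alt_group n). \<Union>s\<in>even_derangements n. {(g, g \<circ> s), (g \<circ> s, g)})"
proof -
  have conj: "h \<circ> s \<circ> inv' h \<in> even_derangements n" "inv' h \<circ> s \<circ> h \<in> even_derangements n"
    if h: "h \<in> carrier (alt_group n)" and s: "s \<in> even_derangements n" for h s
  proof -
    have *: "k \<circ> s \<circ> inv' k \<in> even_derangements n" if k: "k \<in> carrier (alt_group n)" for k
    proof -
      interpret A: group "alt_group n" by (rule alt_group_is_group)
      have sc: "s \<in> carrier (alt_group n)" using s by (simp add: even_derangements_def)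
      have "k \<circ> s \<circ> inv' k \<in> carrier (alt_group n)"
        using A.m_closed[OF A.m_closed[OF k sc] alt_group_inv_closed[OF k]]
        by (simp add: alt_group_mult)
      moreover have "(k \<circ> s \<circ> inv' k) i \<noteq> i" if i: "i \<in> {1..n}" for i
      proof
        have kp: "k permutes {1..n}" using k by (simp add: alt_group_carrier)
        assume "(k \<circ> s \<circ> inv' k) i = i"
        then have "s (inv' k i) = inv' k i"
          using permutes_inverses[OF kp] by (metis comp_apply)
        moreover have "inv' k i \<in> {1..n}"
          using permutes_in_image[OF permutes_inv[OF kp]] i by blast
        ultimately show False using s by (auto simp: even_derangements_def)
      qed
      ultimately show ?thesis by (simp add: even_derangements_def)
    qed
    show "h \<circ> s \<circ> inv' h \<in> even_derangements n" by (rule *[OF h])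
    have "inv' (inv' h) = h"
      using h by (auto simp: alt_group_carrier intro: inv_inv_eq permutes_bij)
    then show "inv' h \<circ> s \<circ> h \<in> even_derangements n"
      using *[OF alt_group_inv_closed[OF h]] by simp
  qed
  have eq: "(\<lambda>s. s \<circ> g) ` even_derangements n = (\<lambda>s. g \<circ> s) ` even_derangements n"
    if g: "g \<in> carrier (alt_group n)" for g
  proof -
    have gp: "g permutes {1..n}" using g by (simp add: alt_group_carrier)
    have "s \<circ> g = g \<circ> (inv' g \<circ> s \<circ> g)" "g \<circ> s = (g \<circ> s \<circ> inv' g) \<circ> g" for s
      using permutes_inverses[OF gp] by (auto simp: fun_eq_iff)
    then show ?thesis using conj[OF g] by blast
  qed
  have "(\<Union>s\<in>even_derangements n. {(g, s \<circ> g), (s \<circ> g, g)})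
      = (\<Union>s\<in>even_derangements n. {(g, g \<circ> s), (g \<circ> s, g)})"
    if g: "g \<in> carrier (alt_group n)" for g
  proof -
    have "(\<Union>x\<in>(\<lambda>s. s \<circ> g) ` even_derangements n. {(g, x), (x, g)})
        = (\<Union>x\<in>(\<lambda>s. g \<circ> s) ` even_derangements n. {(g, x), (x, g)})"
      by (simp only: eq[OF g])
    then show ?thesis by simp
  qed
  then show ?thesis
    by (simp add: alt_derangement_graph_def cayley_graph_def alt_group_mult cong: SUP_cong)
qed

end

theory Submission
  imports Defs
begin

text \<open>
  A tensor power is controlled by walks of one common length: if any two vertices of a graph are
  joined by a walk of length exactly \<open>k > 0\<close>, then the same holds in each of its tensor powers
  (combine the walks coordinatewise), and such a graph is connected and not bipartite.

  To obtain such a \<open>k\<close> for the derangement graph of \<open>A\<^sub>n\<close>, note that for \<open>n \<ge> 5\<close> there is an even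
  derangement \<open>s\<close> with \<open>s a = b\<close> and \<open>s b = c\<close>; then \<open>(a b c) \<circ> s\<close> is again a derangement, so
  \<open>(a b c)\<close> is a product of two even derangements. So is the identity, and the 3-cycles
  generate \<open>A\<^sub>n\<close>; hence every pair of vertices is joined by an even walk, and by going back and forth
  along an edge all these walks can be given the same length.
\<close>

section \<open>Walks of a common length\<close>

lemma relpow_rtrancl_on:
  assumes "(u, v) \<in> R ^^ k" "u \<in> A" "R \<subseteq> A \<times> A"
  shows "(u, v) \<in> rtrancl_on A R"
  using assms
proof (induction k arbitrary: v)
  case 0
  then show ?case by auto
next
  case (Suc k)
  then show ?case
    by (auto elim!: relpow_Suc_E intro: rtrancl_on_into_rtrancl_on)
qed

lemma connected_if_walks_of_length:
  assumes "pair_wf_digraph G" "pverts G \<noteq> {}"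
    and "\<And>u v. u \<in> pverts G \<Longrightarrow> v \<in> pverts G \<Longrightarrow> (u, v) \<in> parcs G ^^ k"
  shows "Digraph_Component.connected (with_proj G)"
proof -
  have "parcs G \<subseteq> pverts G \<times> pverts G"
    using pair_wf_digraph.in_arcsD1[OF assms(1)] pair_wf_digraph.in_arcsD2[OF assms(1)] by auto
  then have "(u, v) \<in> rtrancl_on (pverts G) (parcs G)" if "u \<in> pverts G" "v \<in> pverts G" for u v
    using relpow_rtrancl_on assms(3) that by metis
  \<comment> \<open>The library defines connectedness by reachability in the symmetric closure, so
    reachability along arcs is carried over by monotonicity.\<close>
  moreover have "parcs G \<subseteq> (parcs G)\<^sup>s"
    by (auto simp: symcl_def)
  ultimately show ?thesis
    using assms(2) by (auto simp: connected_conv intro: rtrancl_on_mono[OF _ subset_refl])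
qed

text \<open>Every arc switches sides, so the side on which a walk ends depends only on where it
  starts and on the parity of its length.\<close>

lemma relpow_alternating_iff:
  assumes "(u, v) \<in> R ^^ k" and "\<And>x y. (x, y) \<in> R \<Longrightarrow> y \<in> U \<longleftrightarrow> x \<notin> U"
  shows "v \<in> U \<longleftrightarrow> (u \<in> U \<longleftrightarrow> even k)"
  using assms(1)
proof (induction k arbitrary: v)
  case 0
  then show ?case by auto
next
  case (Suc k)
  then show ?case
    using assms(2) by (auto elim!: relpow_Suc_E)
qed

text \<open>Walks of the same length \<open>k\<close> lead from \<open>u\<close> to itself and to a
  neighbour \<open>v\<close>. By parity \<open>u\<close> and \<open>v\<close> lie on the same side,
  although an arc joins them.\<close>

lemma not_bipartite_if_walks_of_length:
  assumes "pair_wf_digraph G" "pverts G \<noteq> {}" "k > 0"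
    and walk: "\<And>u v. u \<in> pverts G \<Longrightarrow> v \<in> pverts G \<Longrightarrow> (u, v) \<in> parcs G ^^ k"
  shows "\<not> bipartite (with_proj G)"
proof
  assume "bipartite (with_proj G)"
  then obtain U V where "U \<inter> V = {}" "parcs G \<subseteq> U \<times> V \<union> V \<times> U"
    by (auto simp: bipartite_def)
  then have alt: "y \<in> U \<longleftrightarrow> x \<notin> U" if "(x, y) \<in> parcs G" for x y
    using that by blast
  obtain u where u: "u \<in> pverts G" using assms(2) by blast
  \<comment> \<open>Positivity of \<open>k\<close> supplies the arc: it is the first one of a closed
    walk at \<open>u\<close>.\<close>
  obtain j where "k = Suc j" using \<open>k > 0\<close> gr0_implies_Suc by blast
  with walk[OF u u] obtain v where v: "(u, v) \<in> parcs G"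
    by (metis relpow_Suc_D2)
  then have "v \<in> pverts G"
    using pair_wf_digraph.in_arcsD2[OF assms(1)] by blast
  with u have "u \<in> U \<longleftrightarrow> v \<in> U"
    using relpow_alternating_iff[OF walk alt] by blast
  with alt[OF v] show False by blast
qed

lemma tensor_power_walk:
  assumes "length us = q" "length vs = q" "\<forall>i<q. (us ! i, vs ! i) \<in> parcs G ^^ k"
  shows "(us, vs) \<in> parcs (tensor_power G q) ^^ k"
  using assms
proof (induction k arbitrary: vs)
  case 0
  then show ?case by (auto intro: nth_equalityI)
next
  case (Suc k)
  \<comment> \<open>The last but one vertices of the coordinate walks together form the last but one
    vertex in the power; this works because all the walks have the same length.\<close>
  have "\<exists>w. (us ! i, w) \<in> parcs G ^^ k \<and> (w, vs ! i) \<in> parcs G" if "i < q" for i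
    using Suc.prems(3) that by auto
  then obtain w where w: "(us ! i, w i) \<in> parcs G ^^ k" "(w i, vs ! i) \<in> parcs G"
    if "i < q" for i by metis
  have "(us, map w [0..<q]) \<in> parcs (tensor_power G q) ^^ k"
    using w(1) by (intro Suc.IH Suc.prems(1)) auto
  moreover have "(map w [0..<q], vs) \<in> parcs (tensor_power G q)"
    using w(2) Suc.prems(2) by (auto simp: tensor_power_def)
  ultimately show ?case by (rule relpow_Suc_I)
qed

lemma pair_wf_digraph_tensor_power:
  assumes "pair_wf_digraph G"
  shows "pair_wf_digraph (tensor_power G q)"
  using pair_wf_digraph.in_arcsD1[OF assms] pair_wf_digraph.in_arcsD2[OF assms]
  by unfold_locales (fastforce simp: tensor_power_def in_set_conv_nth)+

lemma tensor_power_connected_not_bipartite: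
  assumes "pair_wf_digraph G" "pverts G \<noteq> {}" "k > 0"
    and walk: "\<And>u v. u \<in> pverts G \<Longrightarrow> v \<in> pverts G \<Longrightarrow> (u, v) \<in> parcs G ^^ k"
  shows "Digraph_Component.connected (with_proj (tensor_power G q))"
    and "\<not> bipartite (with_proj (tensor_power G q))"
proof -
  obtain u where "u \<in> pverts G" using assms(2) by blast
  then have "replicate q u \<in> pverts (tensor_power G q)"
    by (auto simp: tensor_power_def)
  then have ne: "pverts (tensor_power G q) \<noteq> {}" by blast
  have walk_power: "(us, vs) \<in> parcs (tensor_power G q) ^^ k"
    if "us \<in> pverts (tensor_power G q)" "vs \<in> pverts (tensor_power G q)" for us vs
    using that by (intro tensor_power_walk) (auto simp: tensor_power_def intro!: walk)
  note wf = pair_wf_digraph_tensor_power[OF assms(1)]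
  show "Digraph_Component.connected (with_proj (tensor_power G q))"
    by (rule connected_if_walks_of_length[OF wf ne walk_power])
  show "\<not> bipartite (with_proj (tensor_power G q))"
    by (rule not_bipartite_if_walks_of_length[OF wf ne \<open>k > 0\<close> walk_power])
qed

text \<open>The walk is lengthened at its start by repeating the loop at \<open>u\<close>.\<close>

lemma reflexive_relpow_mono:
  assumes "(u, v) \<in> R ^^ i" "i \<le> k" "(u, u) \<in> R"
  shows "(u, v) \<in> R ^^ k"
  using assms(2,1)
proof (induction k rule: dec_induct)
  case (step k)
  then show ?case using assms(3) by (blast intro: relpow_Suc_I2)
qed

lemma relpow_mult: "(R ^^ m) ^^ k = R ^^ (m * k)" for R :: "('a \<times> 'a) set"
proof (induction k)
  case (Suc k)
  have "(R ^^ m) ^^ Suc k = R ^^ (m * k + m)"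
    by (simp only: relpow.simps Suc.IH relpow_add)
  then show ?case by (simp add: add.commute)
qed simp

section \<open>Three-cycles as products of two even derangements\<close>

lemma cycle_of_list_nth:
  assumes "cycle cs" "i < length cs"
  shows "cycle_of_list cs (cs ! i) = cs ! (Suc i mod length cs)"
proof -
  have "map (cycle_of_list cs) cs = rotate1 cs"
    using cyclic_rotation[OF assms(1), of 1] by simp
  then show ?thesis
    using assms(2) by (metis nth_map nth_rotate1)
qed

text \<open>Passing to the next index modulo a length of at least 2 moves every index, and the
  entries are distinct.\<close>

lemma cycle_of_list_neq:
  assumes "cycle cs" "length cs \<ge> 2" "x \<in> set cs"
  shows "cycle_of_list cs x \<noteq> x"
proof -
  obtain i where i: "i < length cs" "x = cs ! i"
    using assms(3) by (auto simp: in_set_conv_nth)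
  have "Suc i mod length cs \<noteq> i"
    using assms(2) i(1) by (cases "Suc i = length cs") auto
  moreover have "Suc i mod length cs < length cs"
    using i(1) by (intro mod_less_divisor) linarith
  ultimately show ?thesis
    using i cycle_of_list_nth[OF assms(1) i(1)] nth_eq_iff_index_eq[OF assms(1)] by metis
qed

text \<open>A cycle on \<open>l\<close> points is a product of \<open>l - 1\<close>
  transpositions.\<close>

lemma evenperm_cycle_of_list:
  assumes "cycle cs"
  shows "evenperm (cycle_of_list cs) \<longleftrightarrow> even (length cs - 1)"
  using evenperm_unique[OF swapidseq_ext_imp_swapidseq[OF swapidseq_ext_of_cycles[OF assms]]]
  by blast

text \<open>For odd \<open>n\<close> an \<open>n\<close>-cycle through \<open>a\<close>,
  \<open>b\<close>, \<open>c\<close> is even. For even \<open>n\<close> it would be odd, so two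
  other points are split off into a transposition, leaving an \<open>(n - 2)\<close>-cycle: both
  factors are odd and together they move every point.\<close>

lemma even_derangement_along:
  assumes "n \<ge> 5" "distinct [a, b, c]" "{a, b, c} \<subseteq> {1..n}"
  obtains s where "s \<in> even_derangements n" "s a = b" "s b = c"
proof -
  obtain ds where ds: "set ds = {1..n} - {a, b, c}" "distinct ds"
    using finite_distinct_list[of "{1..n} - {a, b, c}"] by auto
  have "card ({1..n} - {a, b, c}) = n - 3"
    using assms by (subst card_Diff_subset) auto
  with ds have len: "length ds = n - 3"
    by (metis distinct_card)
  have set_n: "{1..n} = {a, b, c} \<union> set ds" and abc_notin: "a \<notin> set ds" "b \<notin> set ds" "c \<notin> set ds"
    using ds(1) assms(3) by blast+
  show thesis
  proof (cases "odd n")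
    case True
    define cs where "cs = a # b # c # ds"
    have cs: "cycle cs" "length cs = n" "set cs = {1..n}"
      unfolding set_n using assms(1,2) ds(2) len abc_notin by (auto simp: cs_def)
    have "cycle_of_list cs permutes {1..n}"
      using cycle_permutes[of cs] cs(3) by simp
    moreover have "evenperm (cycle_of_list cs)"
      using evenperm_cycle_of_list[OF cs(1)] cs(2) True by simp
    moreover have "cycle_of_list cs z \<noteq> z" if "z \<in> {1..n}" for z
      using cycle_of_list_neq[OF cs(1)] cs assms(1) that by simp
    ultimately have "cycle_of_list cs \<in> even_derangements n"
      by (simp add: even_derangements_def alt_group_carrier)
    moreover have "cycle_of_list cs a = b" "cycle_of_list cs b = c"
      using cycle_of_list_nth[OF cs(1), of 0] cycle_of_list_nth[OF cs(1), of 1]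
      by (simp_all add: cs_def)
    ultimately show thesis by (rule that)
  next
    case False
    \<comment> \<open>\<open>ds\<close> has \<open>n - 3 \<ge> 2\<close> entries.\<close>
    obtain x y es where xy: "ds = x # y # es"
      using len assms(1) by (cases ds; cases "tl ds") auto
    define cs where "cs = a # b # c # es"
    have cs: "cycle cs" "length cs = n - 2"
      using assms(1,2) ds(2) len abc_notin unfolding cs_def xy by auto
    have xy_notin: "x \<noteq> y" "x \<notin> set cs" "y \<notin> set cs"
      using ds(2) abc_notin unfolding cs_def xy by auto
    have set_cs: "{1..n} = insert x (insert y (set cs))"
      unfolding set_n cs_def xy by auto
    define s where "s = cycle_of_list cs \<circ> transpose x y"
    have s_cs: "s z = cycle_of_list cs z" if "z \<in> set cs" for z
      using that xy_notin by (auto simp: s_def transpose_def)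
    have s_xy: "s x = y" "s y = x"
      using xy_notin by (auto simp: s_def id_outside_supp)
    have "s permutes {1..n}"
      unfolding s_def set_cs
      by (intro permutes_compose permutes_swap_id permutes_subset[OF cycle_permutes]) auto
    moreover have "evenperm s"
      unfolding s_def
      using False assms(1) xy_notin(1) cs(2)
      by (auto simp: evenperm_comp permutation_of_cycle permutation_swap_id evenperm_swap
          evenperm_cycle_of_list[OF cs(1)])
    moreover have "s z \<noteq> z" if "z \<in> {1..n}" for z
    proof (cases "z \<in> set cs")
      case True
      then show ?thesis
        using s_cs cycle_of_list_neq[OF cs(1)] cs(2) assms(1) by simp
    next
      case False
      then have "z = x \<or> z = y" using that unfolding set_cs by simp
      then show ?thesis using s_xy xy_notin(1) by auto
    qed
    ultimately have "s \<in> even_derangements n"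
      by (auto simp: even_derangements_def alt_group_carrier)
    moreover have "s a = b" "s b = c"
      using s_cs[of a] s_cs[of b] cycle_of_list_nth[OF cs(1), of 0]
        cycle_of_list_nth[OF cs(1), of 1]
      by (simp_all add: cs_def)
    ultimately show thesis by (rule that)
  qed
qed

lemma even_derangements_inv:
  assumes "s \<in> even_derangements n"
  shows "inv' s \<in> even_derangements n"
proof -
  have s: "s \<in> carrier (alt_group n)" "s permutes {1..n}"
    using assms by (auto simp: even_derangements_def alt_group_carrier)
  have "inv' s i \<noteq> i" if "i \<in> {1..n}" for i
    using assms that permutes_inverses(1)[OF s(2), of i] by (auto simp: even_derangements_def)
  then show ?thesis
    using alt_group_inv_closed[OF s(1)] by (auto simp: even_derangements_def)
qed

lemma comp_carrier_alt_group:
  assumes "g \<in> carrier (alt_group n)" "h \<in> carrier (alt_group n)"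
  shows "g \<circ> h \<in> carrier (alt_group n)"
  using group.is_monoid[OF alt_group_is_group, THEN monoid.m_closed, OF assms]
  by (simp add: alt_group_mult)

text \<open>With \<open>s\<close> following \<open>p\<close> along \<open>a\<close>,
  \<open>b\<close>, \<open>c\<close>, the composition \<open>p \<circ> s\<close> is again an even
  derangement, and \<open>p\<close> is recovered by composing it with the inverse of
  \<open>s\<close>.\<close>

lemma three_cycle_eq_comp_even_derangements:
  assumes "n \<ge> 5" "p \<in> three_cycles n"
  obtains s t where "s \<in> even_derangements n" "t \<in> even_derangements n" "p = t \<circ> s"
proof -
  obtain cs where "p = cycle_of_list cs" "cycle cs" "length cs = 3" "set cs \<subseteq> {1..n}"
    using assms(2) by blast
  then obtain a b c where p: "p = cycle_of_list [a, b, c]"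
    and abc: "distinct [a, b, c]" "{a, b, c} \<subseteq> {1..n}"
    by (auto simp: numeral_3_eq_3 length_Suc_conv)
  have p_carrier: "p \<in> carrier (alt_group n)"
    using three_cycles_incl assms(2) by blast
  obtain s where s: "s \<in> even_derangements n" and s_ab: "s a = b" and s_bc: "s b = c"
    by (rule even_derangement_along[OF assms(1) abc])
  have s_carrier: "s \<in> carrier (alt_group n)" and s_perm: "s permutes {1..n}"
    using s by (auto simp: even_derangements_def alt_group_carrier)
  have "(p \<circ> s) i \<noteq> i" if i: "i \<in> {1..n}" for i
  proof
    assume fix_i: "(p \<circ> s) i = i"
    have p_abc: "p a = b" "p b = c" "p c = a"
      using abc(1) by (auto simp: p)
    have "s i \<noteq> i"
      using s i by (auto simp: even_derangements_def)
    \<comment> \<open>Otherwise \<open>p\<close> would fix \<open>s i\<close>, making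
      \<open>i\<close> a fixed point of \<open>s\<close>.\<close>
    then have "s i \<in> {a, b, c}"
      using fix_i id_outside_supp[of "s i" "[a, b, c]"] unfolding p by fastforce
    then have "s b = a \<or> s c = b \<or> s a = c"
      using fix_i p_abc by auto
    \<comment> \<open>The cases \<open>s b = a\<close> and \<open>s a = c\<close> contradict the
      choice of \<open>s\<close>; \<open>s c = b\<close> needs injectivity, since
      \<open>s a = b\<close> already.\<close>
    moreover have "s c \<noteq> s a"
      using abc(1) permutes_inj[OF s_perm] by (auto dest: injD)
    ultimately show False
      using s_ab s_bc abc(1) by auto
  qed
  moreover have "p \<circ> s \<in> carrier (alt_group n)"
    using p_carrier s_carrier by (rule comp_carrier_alt_group)
  ultimately have "p \<circ> s \<in> even_derangements n"
    by (auto simp: even_derangements_def)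
  moreover have "p = (p \<circ> s) \<circ> inv' s"
    using permutes_inverses(1)[OF s_perm] by (simp add: fun_eq_iff)
  ultimately show thesis
    using that even_derangements_inv[OF s] by blast
qed

section \<open>Walks in the derangement graph\<close>

lemma alt_derangement_graph_arc:
  assumes "g \<in> carrier (alt_group n)" "s \<in> even_derangements n"
  shows "(g, s \<circ> g) \<in> parcs (alt_derangement_graph n)"
  using assms by (auto simp: alt_derangement_graph_def cayley_graph_def alt_group_mult)

lemma pverts_alt_derangement_graph: "pverts (alt_derangement_graph n) = carrier (alt_group n)"
  by (simp add: alt_derangement_graph_def cayley_graph_def)

lemma parcs_alt_derangement_graph_subset:
  "parcs (alt_derangement_graph n) \<subseteq> carrier (alt_group n) \<times> carrier (alt_group n)"
  using comp_carrier_alt_group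
  by (auto simp: alt_derangement_graph_def cayley_graph_def alt_group_mult even_derangements_def)

lemma sym_parcs_alt_derangement_graph: "sym (parcs (alt_derangement_graph n))"
  by (auto simp: sym_def alt_derangement_graph_def cayley_graph_def)

lemma pair_wf_digraph_alt_derangement_graph: "pair_wf_digraph (alt_derangement_graph n)"
  using parcs_alt_derangement_graph_subset[of n]
  by unfold_locales (auto simp: pverts_alt_derangement_graph)

lemma finite_parcs_alt_derangement_graph: "finite (parcs (alt_derangement_graph n))"
proof -
  have "carrier (alt_group n) \<subseteq> {p. p permutes {1..n}}"
    by (auto simp: alt_group_carrier)
  then have "finite (carrier (alt_group n))"
    by (rule finite_subset) (simp add: finite_permutations)
  then show ?thesis
    using finite_subset[OF parcs_alt_derangement_graph_subset] by blast
qed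

lemma three_cycle_walk:
  assumes "n \<ge> 5" "p \<in> three_cycles n" "g \<in> carrier (alt_group n)"
  shows "(g, p \<circ> g) \<in> parcs (alt_derangement_graph n) ^^ 2"
proof -
  obtain s t where st: "s \<in> even_derangements n" "t \<in> even_derangements n" "p = t \<circ> s"
    by (rule three_cycle_eq_comp_even_derangements[OF assms(1,2)])
  have "s \<circ> g \<in> carrier (alt_group n)"
    using st(1) assms(3) by (auto simp: even_derangements_def intro: comp_carrier_alt_group)
  then have "(s \<circ> g, p \<circ> g) \<in> parcs (alt_derangement_graph n)"
    using alt_derangement_graph_arc[OF _ st(2)] st(3) by (metis comp_assoc)
  with alt_derangement_graph_arc[OF assms(3) st(1)] show ?thesis
    by (auto simp: numeral_2_eq_2)
qed

lemma sym_relpow_2: "sym R \<Longrightarrow> sym (R ^^ 2)"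
  by (auto simp: numeral_2_eq_2 sym_def)

text \<open>A generator contributes one double step. For the inverse of a 3-cycle, the double step
  that ends at \<open>g\<close> is traversed backwards.\<close>

lemma alt_group_walk:
  assumes "n \<ge> 5" "h \<in> carrier (alt_group n)" "g \<in> carrier (alt_group n)"
  shows "(g, h \<circ> g) \<in> (parcs (alt_derangement_graph n) ^^ 2)\<^sup>*"
proof -
  have "h \<in> generate (alt_group n) (three_cycles n)"
    using assms(2) alt_group_carrier_as_three_cycles by blast
  then show ?thesis
    using assms(3)
  \<comment> \<open>The start \<open>g\<close> must vary: for a product \<open>h1 \<circ> h2\<close>
    the walk for \<open>h1\<close> begins at \<open>h2 \<circ> g\<close>.\<close>
  proof (induction arbitrary: g rule: generate.induct)
    case one
    then show ?case by (simp add: alt_group_one)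
  next
    case (incl p)
    then show ?case using three_cycle_walk[OF assms(1)] by blast
  next
    case (inv p)
    have p: "p \<in> carrier (alt_group n)"
      using inv.hyps three_cycles_incl by blast
    then have "p \<circ> (inv' p \<circ> g) = g"
      using permutes_inverses(1)[of p "{1..n}"] by (auto simp: fun_eq_iff alt_group_carrier)
    moreover have "inv' p \<circ> g \<in> carrier (alt_group n)"
      using alt_group_inv_closed[OF p] inv.prems by (rule comp_carrier_alt_group)
    ultimately have "(inv' p \<circ> g, g) \<in> parcs (alt_derangement_graph n) ^^ 2"
      using three_cycle_walk[OF assms(1) inv.hyps] by metis
    then have "(g, inv' p \<circ> g) \<in> parcs (alt_derangement_graph n) ^^ 2"
      using sym_relpow_2[OF sym_parcs_alt_derangement_graph] by (metis symD)
    then show ?case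
      unfolding alt_group_inv_equality[OF p] by (rule r_into_rtrancl)
  next
    case (eng h1 h2)
    have "h2 \<in> carrier (alt_group n)"
      using eng.hyps(2) alt_group_carrier_as_three_cycles by blast
    then have "h2 \<circ> g \<in> carrier (alt_group n)"
      using eng.prems by (rule comp_carrier_alt_group)
    then show ?case
      using eng.IH(2)[OF eng.prems] eng.IH(1)
      by (metis alt_group_mult comp_assoc rtrancl_trans)
  qed
qed

lemma alt_derangement_graph_walks_of_common_length:
  assumes "n \<ge> 5"
  obtains k where "k > 0"
    "\<And>g h. g \<in> carrier (alt_group n) \<Longrightarrow> h \<in> carrier (alt_group n) \<Longrightarrow>
       (g, h) \<in> parcs (alt_derangement_graph n) ^^ k"
proof -
  let ?E = "parcs (alt_derangement_graph n)"
  \<comment> \<open>In a finite relation, reachable pairs are joined within as many steps as it has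
    pairs, which bounds all the walks at once; \<open>Suc\<close> makes the common length
    positive.\<close>
  let ?m = "Suc (card (?E ^^ 2))"
  have fin: "finite (?E ^^ 2)"
    using finite_parcs_alt_derangement_graph by (intro finite_relpow) auto
  obtain s where s: "s \<in> even_derangements n"
    using even_derangement_along[OF assms, of 1 2 3] assms by auto
  show thesis
  proof (rule that[of "2 * ?m"])
    fix g h
    assume g: "g \<in> carrier (alt_group n)" and h: "h \<in> carrier (alt_group n)"
    have "(g, s \<circ> g) \<in> ?E"
      using alt_derangement_graph_arc[OF g s] .
    \<comment> \<open>Going along an arc and back gives a loop of double steps at every vertex,
      which serves as padding.\<close>
    then have refl: "(g, g) \<in> ?E ^^ 2"
      using symD[OF sym_parcs_alt_derangement_graph] by (auto simp: numeral_2_eq_2)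
    have "(h \<circ> inv' g) \<circ> g = h"
      using g permutes_inverses(2)[of g "{1..n}"] by (auto simp: fun_eq_iff alt_group_carrier)
    moreover have "h \<circ> inv' g \<in> carrier (alt_group n)"
      using h alt_group_inv_closed[OF g] by (rule comp_carrier_alt_group)
    ultimately have "(g, h) \<in> (?E ^^ 2)\<^sup>*"
      using alt_group_walk[OF assms _ g] by metis
    then obtain i where i: "i \<le> card (?E ^^ 2)" "(g, h) \<in> (?E ^^ 2) ^^ i"
      using rtrancl_finite_eq_relpow[OF fin] by auto
    then have "(g, h) \<in> (?E ^^ 2) ^^ ?m"
      using refl by (intro reflexive_relpow_mono[OF i(2)]) auto
    then show "(g, h) \<in> ?E ^^ (2 * ?m)"
      by (simp only: relpow_mult)
  qed simp
qed

theorem theorem2p4: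
  fixes q n :: nat
  assumes "q \<ge> 1" and "n \<ge> 5"
  shows "Digraph_Component.connected (with_proj (tensor_power (alt_derangement_graph n) q)) \<and>
         \<not> bipartite (with_proj (tensor_power (alt_derangement_graph n) q))"
proof -
  obtain k where k: "k > 0"
    "\<And>g h. g \<in> carrier (alt_group n) \<Longrightarrow> h \<in> carrier (alt_group n) \<Longrightarrow>
       (g, h) \<in> parcs (alt_derangement_graph n) ^^ k"
    by (rule alt_derangement_graph_walks_of_common_length[OF assms(2)]) blast
  have "pverts (alt_derangement_graph n) \<noteq> {}"
    using group.is_monoid[OF alt_group_is_group, THEN monoid.one_closed]
    by (auto simp: pverts_alt_derangement_graph)
  then show ?thesis
    using tensor_power_connected_not_bipartite[OF pair_wf_digraph_alt_derangement_graph _ k(1)] k(2)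
    by (simp add: pverts_alt_derangement_graph)
qed

end
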